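(* For $n\geq 0$, the set $\mathcal{SN}c(n)$ of semi-Narayana cow partitions is the set of partitions of $n$ whose parts are of the form $2^k$ or $3\cdot 2^k$ for some $k\geq 0$ and have (pairwise) distinct $2$-adic valuations.
   Context: A partition of $n$ is a weakly decreasing sequence (equivalently, a finite multiset) of positive integers with sum $n$; the empty partition $(\,)$ is the only partition of $0$. $\lambda\sqcup\mu$ is the partition whose multiset of parts is the multiset union of the parts of $\lambda$ and $\mu$; $2\lambda$ is obtained by doubling every part of $\lambda$; these operations are applied elementwise to sets of partitions. The semi-Narayana cow partitions are defined recursively by $\mathcal{SN}c(0)=\{(\,)\}$, $\mathcal{SN}c(1)=\{(1)\}$, and for $n\ge1$: $\mathcal{SN}c(2n)=2\,\mathcal{SN}c(n)$ and $\mathcal{SN}c(2n+1)=\big(\mathcal{SN}c(2n)\sqcup(1)\big)\cup\big(\mathcal{SN}c(2n-2)\sqcup(3)\big)$. *)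

theory Defs
  imports "HOL-Library.Multiset" "HOL-Computational_Algebra.Primes"
begin

text \<open>
  Partitions are represented by the finite multiset of their parts, so the union of partitions
  is multiset addition and the empty partition is the empty multiset.
\<close>

definition partitions_of :: "nat \<Rightarrow> nat multiset set" where
  "partitions_of n = {P. (\<forall>p \<in># P. p > 0) \<and> sum_mset P = n}"

definition double_parts :: "nat multiset \<Rightarrow> nat multiset" where
  "double_parts P = image_mset (\<lambda>p. 2 * p) P"

function SNc :: "nat \<Rightarrow> nat multiset set" where
  "SNc 0 = {{#}}"
| "SNc (Suc 0) = {{#1#}}"
| "n \<ge> 1 \<Longrightarrow> SNc (2 * n) = double_parts ` SNc n"
| "n \<ge> 1 \<Longrightarrow> SNc (2 * n + 1) =
     (\<lambda>P. P + {#1#}) ` SNc (2 * n) \<union> (\<lambda>P. P + {#3#}) ` SNc (2 * n - 2)"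
proof (goal_cases)
  case (1 P x)
  show ?case
  proof (cases "x \<le> 1")
    case True
    then have "x = 0 \<or> x = Suc 0" by auto
    then show P using 1(1,2) by blast
  next
    case False
    then have "x div 2 \<ge> 1" by linarith
    moreover have "x = 2 * (x div 2) \<or> x = 2 * (x div 2) + 1" by presburger
    ultimately show P using 1(3,4) by blast
  qed
next
  case 2 then show ?case by simp
next
  case 3 then show ?case by simp
next
  case 4 then show ?case by simp
next
  case 5 then show ?case by simp
next
  case 6 then show ?case by simp
next
  case 7 then show ?case by presburger
next
  case (8 n) then have False by presburger then show ?case ..
next
  case (9 m n) then have "m = n" by presburger then show ?case by (rule arg_cong)
next
  case 10 then have False by presburger then show ?case ..
next
  case (11 m n) then have "m = n" by presburger then show ?case by (rule arg_cong)
qed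

termination
  by (relation "measure id") auto

text \<open>
  The valuations are collected with multiplicity, so a repeated part violates the condition.
\<close>

definition distinct_2adic_valuations :: "nat multiset \<Rightarrow> bool" where
  "distinct_2adic_valuations P \<longleftrightarrow> (\<forall>v. count (image_mset (multiplicity 2) P) v \<le> 1)"

end

theory Submission imports Defs begin

text \<open>
  The sets described by the theorem have the same initial values as \<open>SNc\<close> and satisfy the same
  recursion, so they agree with it. The point is that the odd parts of a partition are those of valuation \<open>0\<close>,
  so a partition with distinct valuations has at most one odd part, and that part can only be
  \<open>1\<close> or \<open>3\<close>. The parity of \<open>n\<close> decides which case occurs.

  If \<open>n\<close> is even there is no odd part at all, and halving all parts lowers every valuation by
  one and so preserves both the shape of the parts and the distinctness
  (\<open>admissible_sum_double\<close>). If \<open>n\<close> is odd there is exactly one odd part. Removing it leaves an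
  admissible partition of the even number \<open>n - 1\<close> or \<open>n - 3\<close>; conversely such a partition has
  no odd part, so the valuation \<open>0\<close> is free for a new part \<open>1\<close> or \<open>3\<close>
  (\<open>admissible_sum_odd\<close>).
\<close>

definition admissible :: "nat multiset \<Rightarrow> bool" where
  "admissible P \<longleftrightarrow>
     (\<forall>p \<in># P. \<exists>k::nat. p = 2 ^ k \<or> p = 3 * 2 ^ k) \<and> distinct_2adic_valuations P"

lemma admissible_empty: "admissible {#}"
  by (simp add: admissible_def distinct_2adic_valuations_def)

lemma admissible_part_pos: "admissible P \<Longrightarrow> p \<in># P \<Longrightarrow> p > 0"
  by (auto simp: admissible_def)

lemma two_times_part_iff:
  "(\<exists>k. 2 * p = 2 ^ k \<or> 2 * p = 3 * 2 ^ k) \<longleftrightarrow> (\<exists>k. p = 2 ^ k \<or> p = 3 * 2 ^ k)"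
  for p :: nat
proof
  assume "\<exists>k. 2 * p = 2 ^ k \<or> 2 * p = 3 * 2 ^ k"
  then obtain k where k: "2 * p = 2 ^ k \<or> 2 * p = 3 * 2 ^ k" ..
  have "even (2 * p)" by simp
  with k have "k \<noteq> 0" by (intro notI) auto
  then obtain j where "k = Suc j" using not0_implies_Suc by blast
  with k have "p = 2 ^ j \<or> p = 3 * 2 ^ j" by auto
  then show "\<exists>k. p = 2 ^ k \<or> p = 3 * 2 ^ k" ..
next
  assume "\<exists>k. p = 2 ^ k \<or> p = 3 * 2 ^ k"
  then obtain k where "p = 2 ^ k \<or> p = 3 * 2 ^ k" ..
  then have "2 * p = 2 ^ Suc k \<or> 2 * p = 3 * 2 ^ Suc k" by auto
  then show "\<exists>k. 2 * p = 2 ^ k \<or> 2 * p = 3 * 2 ^ k" ..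
qed

lemma odd_part_iff:
  "odd p \<and> (\<exists>k. p = 2 ^ k \<or> p = 3 * 2 ^ k) \<longleftrightarrow> p = 1 \<or> p = 3" for p :: nat
proof
  assume "odd p \<and> (\<exists>k. p = 2 ^ k \<or> p = 3 * 2 ^ k)"
  then obtain k where "odd p" and k: "p = 2 ^ k \<or> p = 3 * 2 ^ k" by blast
  then have "k = 0" by (cases k) auto
  with k show "p = 1 \<or> p = 3" by simp
next
  assume "p = 1 \<or> p = 3"
  then have "odd p" "p = 2 ^ 0 \<or> p = 3 * 2 ^ 0" by auto
  then show "odd p \<and> (\<exists>k. p = 2 ^ k \<or> p = 3 * 2 ^ k)" by blast
qed

lemma distinct_valuations_double_parts:
  assumes "\<forall>p \<in># P. p > 0"
  shows "distinct_2adic_valuations (double_parts P) \<longleftrightarrow> distinct_2adic_valuations P"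
proof -
  let ?V = "image_mset (multiplicity 2) P"
  have "image_mset (multiplicity 2) (double_parts P) = image_mset Suc ?V"
    unfolding double_parts_def multiset.map_comp
    using assms by (intro image_mset_cong) (simp add: multiplicity_times_same)
  moreover have "count (image_mset Suc ?V) (Suc v) = count ?V v" for v
    by (induction P) auto
  moreover have "count (image_mset Suc ?V) 0 = 0"
    by (auto simp: count_eq_zero_iff)
  ultimately show ?thesis
    unfolding distinct_2adic_valuations_def by (metis not0_implies_Suc zero_le)
qed

lemma admissible_double_parts: "admissible (double_parts P) \<longleftrightarrow> admissible P"
proof -
  let ?shape = "\<lambda>p::nat. \<exists>k. p = 2 ^ k \<or> p = 3 * 2 ^ k"
  have "(\<forall>p \<in># double_parts P. ?shape p) \<longleftrightarrow> (\<forall>p \<in># P. ?shape p)"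
    by (simp add: double_parts_def two_times_part_iff)
  moreover have "\<forall>p \<in># P. p > 0" if "\<forall>p \<in># P. ?shape p"
    using that by auto
  ultimately show ?thesis
    unfolding admissible_def using distinct_valuations_double_parts by blast
qed

lemma sum_mset_double_parts: "sum_mset (double_parts P) = 2 * sum_mset P"
  by (induction P) (auto simp: double_parts_def)

lemma even_parts_imp_double_parts:
  assumes "\<forall>p \<in># P. even p"
  obtains Q where "P = double_parts Q"
proof
  have "image_mset (\<lambda>p. 2 * (p div 2)) P = image_mset (\<lambda>p. p) P"
    using assms by (intro image_mset_cong) simp
  then show "P = double_parts (image_mset (\<lambda>p. p div 2) P)"
    by (simp add: double_parts_def multiset.map_comp comp_def)
qed

lemma sum_mset_even:
  fixes P :: "nat multiset"
  assumes "\<forall>p \<in># P. even p"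
  shows "even (sum_mset P)"
  using assms by (induction P) auto

text \<open>
  An odd part has valuation \<open>0\<close>, so it can share an admissible partition only with even parts.
\<close>

lemma admissible_add_odd_iff:
  assumes "odd p"
  shows "admissible (add_mset p P) \<longleftrightarrow>
    (p = 1 \<or> p = 3) \<and> admissible P \<and> (\<forall>q \<in># P. even q)"
proof -
  let ?V = "image_mset (multiplicity 2) P"
  have "multiplicity 2 p = 0"
    using assms by (rule not_dvd_imp_multiplicity_0)
  then have "count (image_mset (multiplicity 2) (add_mset p P)) v \<le> 1 \<longleftrightarrow>
      count ?V v \<le> 1 \<and> (v = 0 \<longrightarrow> count ?V 0 = 0)" for v
    by auto
  then have valuations: "distinct_2adic_valuations (add_mset p P) \<longleftrightarrow>
      distinct_2adic_valuations P \<and> count ?V 0 = 0"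
    unfolding distinct_2adic_valuations_def by blast
  have even_iff: "count ?V 0 = 0 \<longleftrightarrow> (\<forall>q \<in># P. even q)" if "admissible P"
  proof -
    have "multiplicity 2 q \<noteq> 0 \<longleftrightarrow> even q" if "q \<in># P" for q
      using admissible_part_pos[OF \<open>admissible P\<close> that]
      by (simp add: multiplicity_eq_zero_iff)
    then show ?thesis
      unfolding count_eq_zero_iff set_image_mset by (metis image_iff)
  qed
  have "admissible (add_mset p P) \<longleftrightarrow>
      (p = 1 \<or> p = 3) \<and> admissible P \<and> count ?V 0 = 0"
    using odd_part_iff[of p] assms valuations
    unfolding admissible_def set_mset_add_mset_insert ball_simps by blast
  with even_iff show ?thesis by metis
qed

lemma admissible_even_sum_imp_even_parts:
  assumes "admissible P" "even (sum_mset P)"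
  shows "\<forall>p \<in># P. even p"
proof (rule ccontr)
  assume "\<not> (\<forall>p \<in># P. even p)"
  then obtain p Q where P: "P = add_mset p Q" and "odd p"
    by (metis mset_add)
  with assms(1) have "\<forall>q \<in># Q. even q"
    by (simp add: admissible_add_odd_iff)
  with assms(2) P \<open>odd p\<close> sum_mset_even[of Q] show False by simp
qed

lemma admissible_sum_double:
  "{P. admissible P \<and> sum_mset P = 2 * n} =
     double_parts ` {P. admissible P \<and> sum_mset P = n}"
proof (intro equalityI subsetI)
  fix P assume "P \<in> {P. admissible P \<and> sum_mset P = 2 * n}"
  then have P: "admissible P" "sum_mset P = 2 * n" by auto
  obtain Q where "P = double_parts Q"
    using admissible_even_sum_imp_even_parts[OF P(1)] P(2) even_parts_imp_double_parts
    by (metis dvd_triv_left)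
  with P show "P \<in> double_parts ` {P. admissible P \<and> sum_mset P = n}"
    by (auto simp: admissible_double_parts sum_mset_double_parts)
next
  fix P assume "P \<in> double_parts ` {P. admissible P \<and> sum_mset P = n}"
  then show "P \<in> {P. admissible P \<and> sum_mset P = 2 * n}"
    by (auto simp: admissible_double_parts sum_mset_double_parts)
qed

text \<open>
  For \<open>n = 0\<close> the truncated difference \<open>2 * n - 2\<close> would be \<open>0\<close>, and the right-hand side would
  contain \<open>(3)\<close>, which is not a partition of \<open>1\<close>.
\<close>

lemma admissible_sum_odd:
  assumes "n \<ge> 1"
  shows "{P. admissible P \<and> sum_mset P = 2 * n + 1} =
    (\<lambda>P. P + {#1#}) ` {P. admissible P \<and> sum_mset P = 2 * n} \<union>
    (\<lambda>P. P + {#3#}) ` {P. admissible P \<and> sum_mset P = 2 * n - 2}"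
    (is "?L = ?R1 \<union> ?R3")
proof (intro equalityI subsetI)
  fix P assume "P \<in> ?L"
  then have P: "admissible P" "sum_mset P = 2 * n + 1" by auto
  then have "\<not> (\<forall>p \<in># P. even p)"
    using sum_mset_even[of P] by auto
  then obtain p Q where PQ: "P = add_mset p Q" and "odd p"
    by (metis mset_add)
  with P(1) have "p = 1 \<or> p = 3" "admissible Q"
    by (auto simp: admissible_add_odd_iff)
  then show "P \<in> ?R1 \<union> ?R3"
    using P(2) PQ by auto
next
  fix P assume "P \<in> ?R1 \<union> ?R3"
  then obtain p Q where P: "P = add_mset p Q" and p: "p = 1 \<or> p = 3"
    and Q: "admissible Q" "p + sum_mset Q = 2 * n + 1"
    using assms by auto
  have "odd p" using p by auto
  moreover from this Q(2) have "even (sum_mset Q)" by presburger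
  then have "\<forall>q \<in># Q. even q"
    by (rule admissible_even_sum_imp_even_parts[OF Q(1)])
  ultimately show "P \<in> ?L"
    using P p Q by (simp add: admissible_add_odd_iff)
qed

lemma admissible_sum_0: "{P. admissible P \<and> sum_mset P = 0} = {{#}}"
proof (intro equalityI subsetI)
  fix P :: "nat multiset" assume "P \<in> {P. admissible P \<and> sum_mset P = 0}"
  then have P: "admissible P" "\<forall>p \<in># P. p = 0" by auto
  then have "p \<notin># P" for p
    using admissible_part_pos[of P p] by auto
  then show "P \<in> {{#}}" by (simp add: multiset_eq_iff not_in_iff)
qed (simp add: admissible_empty)

lemma admissible_sum_1: "{P. admissible P \<and> sum_mset P = 1} = {{#1#}}"
proof (intro equalityI subsetI)
  fix P assume "P \<in> {P. admissible P \<and> sum_mset P = 1}"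
  then have P: "admissible P" "sum_mset P = 1" by auto
  then obtain p Q where PQ: "P = add_mset p Q" "odd p"
    using sum_mset_even[of P] by (metis mset_add odd_one)
  with P have "p = 1" "admissible Q" "sum_mset Q = 0"
    by (auto simp: admissible_add_odd_iff)
  with PQ admissible_sum_0 show "P \<in> {{#1#}}" by blast
next
  fix P :: "nat multiset" assume "P \<in> {{#1#}}"
  then show "P \<in> {P. admissible P \<and> sum_mset P = 1}"
    by (simp add: admissible_add_odd_iff admissible_empty)
qed

lemma SNc_eq_admissible: "SNc n = {P. admissible P \<and> sum_mset P = n}"
proof (induction n rule: SNc.induct)
  case 1
  then show ?case by (simp only: SNc.simps(1) admissible_sum_0)
next
  case 2
  then show ?case using admissible_sum_1 by simp
next
  case (3 n)
  then show ?case by (simp only: SNc.simps admissible_sum_double)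
next
  case (4 n)
  then show ?case by (simp only: SNc.simps(4) admissible_sum_odd)
qed

theorem theorem7p1:
  fixes n :: nat
  shows "SNc n = {P \<in> partitions_of n.
           (\<forall>p \<in># P. \<exists>k::nat. p = 2 ^ k \<or> p = 3 * 2 ^ k) \<and> distinct_2adic_valuations P}"
proof -
  have "admissible P \<and> sum_mset P = n \<longleftrightarrow> P \<in> partitions_of n \<and> admissible P" for P
    unfolding partitions_of_def using admissible_part_pos[of P] by blast
  then show ?thesis
    unfolding SNc_eq_admissible by (simp add: admissible_def)
qed

end
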